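(* Let $G$ be an arbitrary topological group. Then each continuous semipolynomial $f:G\to\mathbb{C}$ of degree at most one is a polynomial of degree at most two. That is, if $\Delta_h^2f=0$ for all $h\in G$, then $\Delta_{h_3}\Delta_{h_2}\Delta_{h_1}f=0$ for all $h_1,h_2,h_3\in G$.
   Context: Discrete groups are a special case of topological groups. For $h\in G$ and $f:G\to\mathbb{C}$, $(\Delta_hf)(x)=f(xh)-f(x)$. A function $f$ is a polynomial of degree at most $n$ if $\Delta_{h_{n+1}}\cdots\Delta_{h_1}f=0$ for all $h_1,\dots,h_{n+1}\in G$; it is a semipolynomial of degree at most $n$ if $\Delta_h^{n+1}f=0$ for all $h\in G$. *)

theory Defs
  imports Complex_Main
begin

(* Groups are written additively, as in the library: the class group_add is not assumed
   commutative, so x + h stands for the product xh of a general (possibly nonabelian) group,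
   and the order of the summands matters. *)

definition fdiff :: "'a::group_add \<Rightarrow> ('a \<Rightarrow> complex) \<Rightarrow> 'a \<Rightarrow> complex" where
  "fdiff h f = (\<lambda>x. f (x + h) - f x)"

(* fold applies the operators from left to right:
   fold fdiff [h1, ..., hk] f = fdiff hk (... (fdiff h1 f)). *)

definition polynomial_deg_le :: "nat \<Rightarrow> ('a::group_add \<Rightarrow> complex) \<Rightarrow> bool" where
  "polynomial_deg_le n f \<longleftrightarrow>
     (\<forall>hs. length hs = n + 1 \<longrightarrow> fold fdiff hs f = (\<lambda>x. 0))"

definition semipolynomial_deg_le :: "nat \<Rightarrow> ('a::group_add \<Rightarrow> complex) \<Rightarrow> bool" where
  "semipolynomial_deg_le n f \<longleftrightarrow> (\<forall>h. (fdiff h ^^ (n + 1)) f = (\<lambda>x. 0))"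

lemma semipolynomial_deg_le_1_iff:
  "semipolynomial_deg_le 1 f \<longleftrightarrow> (\<forall>h. fdiff h (fdiff h f) = (\<lambda>x. 0))"
  by (simp add: semipolynomial_deg_le_def numeral_2_eq_2)

lemma polynomial_deg_le_2_iff:
  "polynomial_deg_le 2 f \<longleftrightarrow>
     (\<forall>h1 h2 h3. fdiff h3 (fdiff h2 (fdiff h1 f)) = (\<lambda>x. 0))"
proof
  assume "polynomial_deg_le 2 f"
  then have "fold fdiff [h1, h2, h3] f = (\<lambda>x. 0)" for h1 h2 h3
    unfolding polynomial_deg_le_def by (elim allE[of _ "[h1, h2, h3]"]) simp
  then show "\<forall>h1 h2 h3. fdiff h3 (fdiff h2 (fdiff h1 f)) = (\<lambda>x. 0)"
    by simp
next
  assume "\<forall>h1 h2 h3. fdiff h3 (fdiff h2 (fdiff h1 f)) = (\<lambda>x. 0)"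
  then show "polynomial_deg_le 2 f"
    unfolding polynomial_deg_le_def by (auto simp: eval_nat_numeral length_Suc_conv)
qed

end

theory Submission
  imports Defs
begin

text \<open>
  Let \<open>M\<close> be the span of the right translates of \<open>f\<close>. The condition on \<open>f\<close> is stable under
  conjugating the step, so every group element \<open>g\<close> acts on \<open>M\<close> with \<open>(g - 1)\<^sup>2 = 0\<close>, that is,
  \<open>g\<^sup>-\<^sup>1 = 2 - g\<close>. Put \<open>a = g - 1\<close>, \<open>b = h - 1\<close>, \<open>c = k - 1\<close>. Expanding \<open>gh + (gh)\<^sup>-\<^sup>1 = 2\<close>
  gives \<open>ab = -ba\<close>. Hence \<open>c\<close> commutes with \<open>ab\<close>; but it anticommutes with \<open>a\<close>, \<open>b\<close> and
  \<open>gh - 1 = a + b + ab\<close>, so it also anticommutes with \<open>ab\<close>. Therefore \<open>2abc = 0\<close>.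
\<close>

text \<open>The free \<open>z\<close> lets the rule act in the middle of a noncommutative
  sum.\<close>

lemma semipolynomial_deg_le_1_minus:
  fixes f :: "'a::group_add \<Rightarrow> complex"
  assumes "semipolynomial_deg_le 1 f"
  shows "f (y + - h + z) = 2 * f (y + z) - f (y + h + z)"
proof -
  \<comment> \<open>The step \<open>h\<close> to the left of \<open>z\<close> is the conjugate step \<open>- z + h + z\<close> to its right.\<close>
  have "fdiff (- z + h + z) (fdiff (- z + h + z) f) (y + - h + z) = 0"
    using assms by (simp only: semipolynomial_deg_le_1_iff)
  moreover have "y + - h + z + (- z + h + z) = y + z"
    and "y + z + (- z + h + z) = y + h + z"
    by (simp_all add: add.assoc del: add_uminus_conv_diff)
  ultimately have "f (y + h + z) - f (y + z) - (f (y + z) - f (y + - h + z)) = 0"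
    by (simp only: fdiff_def)
  then show ?thesis
    by algebra
qed

text \<open>Removing the minus from \<open>- (g + h)\<close> at once, or from \<open>- h\<close> and
  \<open>- g\<close> in turn, must give the same value.\<close>

lemma semipolynomial_deg_le_1_anticommute:
  fixes f :: "'a::group_add \<Rightarrow> complex"
  assumes "semipolynomial_deg_le 1 f"
  shows "f (y + g + h + z) + f (y + h + g + z) =
    2 * f (y + g + z) + 2 * f (y + h + z) - 2 * f (y + z)"
proof -
  note minus = semipolynomial_deg_le_1_minus[OF assms]
  have "f (y + g + h + z) = 2 * f (y + z) - f (y + - h + - g + z)"
    using minus[of y "g + h" z] by (simp add: minus_add add.assoc del: add_uminus_conv_diff)
  also have "f (y + - h + - g + z) = 2 * f (y + - h + z) - f (y + - h + (g + z))"
    using minus[of "y + - h" g z] by (simp add: add.assoc del: add_uminus_conv_diff)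
  also have "\<dots> = 2 * (2 * f (y + z) - f (y + h + z)) - (2 * f (y + g + z) - f (y + h + g + z))"
    using minus[of y h z] minus[of y h "g + z"]
    by (simp add: add.assoc del: add_uminus_conv_diff)
  finally show ?thesis
    by (simp add: algebra_simps)
qed

theorem corollary3p11:
  fixes f :: "'a::topological_group_add \<Rightarrow> complex"
  assumes "continuous_on UNIV f"
    and "semipolynomial_deg_le 1 f"
  shows "polynomial_deg_le 2 f"
proof -
  note anticommute = semipolynomial_deg_le_1_anticommute[OF assms(2)]
  have "fdiff k (fdiff h (fdiff g f)) x = 0" for g h k x
  proof -
    \<comment> \<open>Moving \<open>k\<close> past \<open>h\<close>, past \<open>g\<close> and past
      \<open>h + g\<close> gives three identities; first minus second plus third isolates
      \<open>2 * f (x + k + h + g)\<close>.\<close>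
    have "f (x + k + h + g) + f (x + h + k + g) =
        2 * f (x + k + g) + 2 * f (x + h + g) - 2 * f (x + g)"
      by (rule anticommute)
    moreover have "f (x + h + k + g) + f (x + h + g + k) =
        2 * f (x + h + k) + 2 * f (x + h + g) - 2 * f (x + h)"
      using anticommute[of "x + h" k g 0] by simp
    moreover have "f (x + k + h + g) + f (x + h + g + k) =
        2 * f (x + k) + 2 * f (x + h + g) - 2 * f x"
      using anticommute[of x k "h + g" 0] by (simp add: add.assoc)
    \<comment> \<open>This trades the leftover \<open>f (x + h + k)\<close> for
      \<open>f (x + k + h)\<close>, which occurs in the difference.\<close>
    moreover have "f (x + k + h) + f (x + h + k) =
        2 * f (x + k) + 2 * f (x + h) - 2 * f x"
      using anticommute[of x k h 0] by simp
    ultimately have "2 * fdiff k (fdiff h (fdiff g f)) x = 0"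
      unfolding fdiff_def by algebra
    then show ?thesis
      by simp
  qed
  then show ?thesis
    by (simp add: polynomial_deg_le_2_iff fun_eq_iff)
qed

end
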